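(* Let $y$ be the random state, $y_D$ the deterministic target, $u$ the deterministic control, and let $\alpha,\gamma,\gamma'$ be real constants. Assume $\|\mathbb{S}[y]\|\neq 0$. Then $J_{\mathrm{rob}}(y,u)=J_{\mathrm{av}}(y,u)$ if and only if $\gamma'=1+\gamma$, where $$J_{\mathrm{rob}}(y,u)=\mathbb{E}\big[\|y-y_D\|^2\big]+\gamma\,\|\mathbb{S}[y]\|^2+\alpha\|u\|^2,$$ $$J_{\mathrm{av}}(y,u)=\|\mathbb{E}[y]-y_D\|^2+\gamma'\,\|\mathbb{S}[y]\|^2+\alpha\|u\|^2 .$$
   Context: $(\Omega,\mathcal{A},\mu)$ is a probability space and $D\subset\mathbb{R}^d$ a spatial domain. The state $y=y(x,\omega)$ belongs to $L^2(D)\otimes L^2(\Omega)$ (square integrable on $D\times\Omega$); the target $y_D\in L^2(D)$ and the control $u\in L^2(D)$ are deterministic. $\|\cdot\|$ is the $L^2(D)$-norm. For a random quantity $k$, $\mathbb{E}[k]=\int_\Omega k\,d\mu(\omega)$, $\mathbb{V}[k]=\mathbb{E}[(k-\mathbb{E}[k])^2]$ and $\mathbb{S}[k]=\sqrt{\mathbb{V}[k]}$. Applied to $y$, these are taken pointwise in $x\in D$, so that $\mathbb{E}[y]$, $\mathbb{V}[y]$, $\mathbb{S}[y]$ are functions on $D$ and $\|\mathbb{S}[y]\|^2=\int_D\mathbb{V}[y]\,dx$. *)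

theory Defs
  imports "HOL-Probability.Probability"
begin

text \<open>
  Elements of $L^2$ are represented by square integrable measurable functions.
\<close>

definition L2 :: "'a measure \<Rightarrow> ('a \<Rightarrow> real) set" where
  "L2 M = {f \<in> borel_measurable M. integrable M (\<lambda>x. (f x)\<^sup>2)}"

definition L2_norm :: "'a measure \<Rightarrow> ('a \<Rightarrow> real) \<Rightarrow> real" where
  "L2_norm M f = sqrt (\<integral>x. (f x)\<^sup>2 \<partial>M)"

definition std_deviation :: "'w measure \<Rightarrow> ('w \<Rightarrow> real) \<Rightarrow> real" where
  "std_deviation P k = sqrt (prob_space.variance P k)"

text \<open>
  For a random field, mean and standard deviation are taken pointwise in the spatial
  variable.  If \<open>y\<close> is square integrable on the product, then the section at \<open>x\<close> is
  square integrable for almost every \<open>x\<close>; on the remaining null set the values below are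
  arbitrary and do not affect any spatial integral.
\<close>

definition mean_field :: "'w measure \<Rightarrow> ('x \<times> 'w \<Rightarrow> real) \<Rightarrow> 'x \<Rightarrow> real" where
  "mean_field P y x = prob_space.expectation P (\<lambda>\<omega>. y (x, \<omega>))"

definition std_field :: "'w measure \<Rightarrow> ('x \<times> 'w \<Rightarrow> real) \<Rightarrow> 'x \<Rightarrow> real" where
  "std_field P y x = std_deviation P (\<lambda>\<omega>. y (x, \<omega>))"

definition J_rob :: "'w measure \<Rightarrow> (real^'d) set \<Rightarrow> (real^'d \<Rightarrow> real) \<Rightarrow> real \<Rightarrow> real
    \<Rightarrow> ((real^'d) \<times> 'w \<Rightarrow> real) \<Rightarrow> (real^'d \<Rightarrow> real) \<Rightarrow> real" where
  "J_rob P D yD \<alpha> \<gamma> y u =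
     prob_space.expectation P (\<lambda>\<omega>. (L2_norm (lebesgue_on D) (\<lambda>x. y (x, \<omega>) - yD x))\<^sup>2)
     + \<gamma> * (L2_norm (lebesgue_on D) (std_field P y))\<^sup>2
     + \<alpha> * (L2_norm (lebesgue_on D) u)\<^sup>2"

definition J_av :: "'w measure \<Rightarrow> (real^'d) set \<Rightarrow> (real^'d \<Rightarrow> real) \<Rightarrow> real \<Rightarrow> real
    \<Rightarrow> ((real^'d) \<times> 'w \<Rightarrow> real) \<Rightarrow> (real^'d \<Rightarrow> real) \<Rightarrow> real" where
  "J_av P D yD \<alpha> \<gamma>' y u =
     (L2_norm (lebesgue_on D) (\<lambda>x. mean_field P y x - yD x))\<^sup>2
     + \<gamma>' * (L2_norm (lebesgue_on D) (std_field P y))\<^sup>2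
     + \<alpha> * (L2_norm (lebesgue_on D) u)\<^sup>2"

end

theory Submission
  imports Defs
begin

text \<open>
  Expanding the square around the mean gives the bias-variance decomposition
  \<open>E[(k - c)\<^sup>2] = V[k] + (E[k] - c)\<^sup>2\<close> for a square integrable random variable \<open>k\<close> and
  a constant \<open>c\<close>.  Apply it, for almost every \<open>x\<close>, to \<open>k = y(x, \<cdot>)\<close> and \<open>c = y\<^sub>D(x)\<close>, and
  integrate over \<open>x\<close>.  Since Fubini's theorem interchanges the spatial integral and the
  expectation, the result is
  \<open>E[\<parallel>y - y\<^sub>D\<parallel>\<^sup>2] = \<parallel>S[y]\<parallel>\<^sup>2 + \<parallel>E[y] - y\<^sub>D\<parallel>\<^sup>2\<close> (\<open>expected_tracking_error_split\<close>).

  The two cost functionals therefore differ by \<open>(1 + \<gamma> - \<gamma>') \<parallel>S[y]\<parallel>\<^sup>2\<close>, and for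
  \<open>\<parallel>S[y]\<parallel> \<noteq> 0\<close> this difference is zero exactly when its first factor is.
\<close>

text \<open>
  Fubini's theorem needs a \<open>\<sigma>\<close>-finite spatial measure.  A countable cover by sets of finite
  measure remains one after completion, so Lebesgue measure inherits this from its Borel
  restriction.
\<close>

lemma sigma_finite_measure_completion:
  assumes "sigma_finite_measure M"
  shows "sigma_finite_measure (completion M)"
proof -
  interpret sigma_finite_measure M by fact
  from sigma_finite_countable obtain C
    where "countable C" "C \<subseteq> sets M" "\<Union>C = space M" "\<forall>a\<in>C. emeasure M a \<noteq> \<infinity>"
    by blast
  moreover from this have "emeasure (completion M) a = emeasure M a" if "a \<in> C" for a
    using that by (auto simp: subset_eq)
  ultimately show ?thesis
    by (intro sigma_finite_measure.intro exI[of _ C]) auto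
qed

lemma L2_norm_square: "(L2_norm M f)\<^sup>2 = (\<integral>x. (f x)\<^sup>2 \<partial>M)"
  by (simp add: L2_norm_def)

lemma (in prob_space) std_deviation_square: "(std_deviation M k)\<^sup>2 = variance k"
  by (simp add: std_deviation_def variance_positive)

lemma (in prob_space) L2_imp_integrable:
  assumes "k \<in> L2 M"
  shows "integrable M k"
  by (rule square_integrable_imp_integrable) (use assms in \<open>auto simp: L2_def\<close>)

lemma (in prob_space) expectation_square_deviation:
  assumes "k \<in> L2 M"
  shows "expectation (\<lambda>\<omega>. (k \<omega> - c)\<^sup>2) = variance k + (expectation k - c)\<^sup>2"
proof -
  have k: "integrable M k" and k2: "integrable M (\<lambda>\<omega>. (k \<omega>)\<^sup>2)"
    using assms L2_imp_integrable[OF assms] by (simp_all add: L2_def)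
  have "expectation (\<lambda>\<omega>. (k \<omega> - c)\<^sup>2) = expectation (\<lambda>\<omega>. (k \<omega>)\<^sup>2) - 2 * expectation k * c + c\<^sup>2"
    using k k2 by (simp add: power2_diff prob_space)
  then show ?thesis
    using variance_eq[OF k k2] by (simp add: power2_diff[of "expectation k" c])
qed

lemma L2_diff:
  assumes "f \<in> L2 M" "g \<in> L2 M"
  shows "(\<lambda>x. f x - g x) \<in> L2 M"
proof -
  have [measurable]: "f \<in> borel_measurable M" "g \<in> borel_measurable M"
    and int: "integrable M (\<lambda>x. 2 * (f x)\<^sup>2 + 2 * (g x)\<^sup>2)"
    using assms by (auto simp: L2_def)
  \<comment> \<open>The difference of the two sides is \<open>(f x + g x)\<^sup>2\<close>.\<close>
  have "(f x - g x)\<^sup>2 \<le> 2 * (f x)\<^sup>2 + 2 * (g x)\<^sup>2" for x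
    using zero_le_power2[of "f x + g x"] by (simp add: power2_sum power2_diff)
  then have "integrable M (\<lambda>x. (f x - g x)\<^sup>2)"
    by (intro Bochner_Integration.integrable_bound[OF int]) simp_all
  then show ?thesis
    by (simp add: L2_def)
qed

text \<open>
  A function of the first variable stays square integrable on the product because the second
  factor has finite total mass.
\<close>

lemma L2_comp_fst:
  assumes "sigma_finite_measure M" "finite_measure P" "f \<in> L2 M"
  shows "(\<lambda>z. f (fst z)) \<in> L2 (M \<Otimes>\<^sub>M P)"
proof -
  interpret P: finite_measure P by fact
  interpret pair_sigma_finite M P
    using assms(1) P.sigma_finite_measure_axioms by (simp add: pair_sigma_finite_def)
  have [measurable]: "f \<in> borel_measurable M" and "integrable M (\<lambda>x. (f x)\<^sup>2)"
    using assms(3) by (auto simp: L2_def)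
  then have "integrable (M \<Otimes>\<^sub>M P) (\<lambda>z. (f (fst z))\<^sup>2)"
    by (intro Fubini_integrable) auto
  then show ?thesis
    by (simp add: L2_def)
qed

lemma AE_section_in_L2:
  assumes "sigma_finite_measure M" "sigma_finite_measure P" "y \<in> L2 (M \<Otimes>\<^sub>M P)"
  shows "AE x in M. (\<lambda>\<omega>. y (x, \<omega>)) \<in> L2 P"
proof -
  interpret pair_sigma_finite M P
    using assms by (simp add: pair_sigma_finite_def)
  have [measurable]: "y \<in> borel_measurable (M \<Otimes>\<^sub>M P)"
    and "integrable (M \<Otimes>\<^sub>M P) (\<lambda>z. (y z)\<^sup>2)"
    using assms(3) by (auto simp: L2_def)
  from AE_integrable_fst'[OF this(2)] show ?thesis
    by (rule AE_mp) (auto simp: L2_def)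
qed

text \<open>
  This is the pointwise bias-variance decomposition integrated over space.  The pointwise
  identity holds only where the section of \<open>y\<close> is square integrable, hence almost everywhere,
  which suffices for the integrals.
\<close>

lemma expected_tracking_error_split:
  assumes "sigma_finite_measure M" "prob_space P"
    and y: "y \<in> L2 (M \<Otimes>\<^sub>M P)" and yD: "yD \<in> L2 M"
  shows "(\<integral>\<omega>. (L2_norm M (\<lambda>x. y (x, \<omega>) - yD x))\<^sup>2 \<partial>P) =
    (L2_norm M (std_field P y))\<^sup>2 + (L2_norm M (\<lambda>x. mean_field P y x - yD x))\<^sup>2"
proof -
  interpret P: prob_space P by fact
  have sigmaP: "sigma_finite_measure P" ..
  interpret pair_sigma_finite M P
    using assms(1) sigmaP by (simp add: pair_sigma_finite_def)
  define err where "err = (\<lambda>x. \<integral>\<omega>. (y (x, \<omega>) - yD x)\<^sup>2 \<partial>P)"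
  define var where "var = (\<lambda>x. (std_field P y x)\<^sup>2)"
  define bias where "bias = (\<lambda>x. (mean_field P y x - yD x)\<^sup>2)"
  have [measurable]: "y \<in> borel_measurable (M \<Otimes>\<^sub>M P)" "yD \<in> borel_measurable M"
    using y yD by (auto simp: L2_def)
  have int: "integrable (M \<Otimes>\<^sub>M P) (\<lambda>(x, \<omega>). (y (x, \<omega>) - yD x)\<^sup>2)"
    using L2_diff[OF y L2_comp_fst[OF assms(1) P.finite_measure_axioms yD]]
    by (simp add: L2_def case_prod_unfold)
  then have err_int: "integrable M err"
    unfolding err_def by (rule integrable_fst)
  have [measurable]: "var \<in> borel_measurable M" "bias \<in> borel_measurable M"
    unfolding var_def bias_def std_field_def mean_field_def P.std_deviation_square
    by measurable
  have split: "AE x in M. err x = var x + bias x"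
    using AE_section_in_L2[OF assms(1) sigmaP y]
  proof eventually_elim
    case (elim x)
    show ?case
      unfolding err_def var_def bias_def std_field_def mean_field_def P.std_deviation_square
      by (rule P.expectation_square_deviation[OF elim])
  qed
  \<comment> \<open>Both parts are nonnegative, so each inherits integrability from their sum.\<close>
  have nonneg: "0 \<le> var x" "0 \<le> bias x" for x
    by (simp_all add: var_def bias_def)
  from split have "AE x in M. norm (var x) \<le> norm (err x)"
    by eventually_elim (simp add: nonneg)
  then have var_int: "integrable M var"
    by (intro Bochner_Integration.integrable_bound[OF err_int]) simp_all
  from split have "AE x in M. norm (bias x) \<le> norm (err x)"
    by eventually_elim (simp add: nonneg)
  then have bias_int: "integrable M bias"
    by (intro Bochner_Integration.integrable_bound[OF err_int]) simp_all
  have "(\<integral>x. err x \<partial>M) = (\<integral>x. var x + bias x \<partial>M)"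
    using err_int split by (intro integral_cong_AE) simp_all
  also have "\<dots> = (\<integral>x. var x \<partial>M) + (\<integral>x. bias x \<partial>M)"
    using var_int bias_int by simp
  finally have "(\<integral>x. err x \<partial>M) = (\<integral>x. var x \<partial>M) + (\<integral>x. bias x \<partial>M)" .
  moreover have "(\<integral>\<omega>. (\<integral>x. (y (x, \<omega>) - yD x)\<^sup>2 \<partial>M) \<partial>P) = (\<integral>x. err x \<partial>M)"
    unfolding err_def by (rule Fubini_integral[OF int])
  ultimately show ?thesis
    by (simp add: L2_norm_square var_def bias_def)
qed

theorem theorem2p1:
  fixes P :: "'w measure"
    and D :: "(real^'d) set"
    and y :: "(real^'d) \<times> 'w \<Rightarrow> real"
    and yD u :: "real^'d \<Rightarrow> real"
    and \<alpha> \<gamma> \<gamma>' :: real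
  assumes "prob_space P"
    and "D \<in> sets lebesgue"
    and "y \<in> L2 (lebesgue_on D \<Otimes>\<^sub>M P)"
    and "yD \<in> L2 (lebesgue_on D)"
    and "u \<in> L2 (lebesgue_on D)"
    and "L2_norm (lebesgue_on D) (std_field P y) \<noteq> 0"
  shows "J_rob P D yD \<alpha> \<gamma> y u = J_av P D yD \<alpha> \<gamma>' y u \<longleftrightarrow> \<gamma>' = 1 + \<gamma>"
proof -
  define s where "s = (L2_norm (lebesgue_on D) (std_field P y))\<^sup>2"
  have "sigma_finite_measure (lebesgue_on D)"
    using assms(2) by (intro sigma_finite_measure_restrict_space
        sigma_finite_measure_completion sigma_finite_lborel)
  from expected_tracking_error_split[OF this assms(1,3,4)]
  have "J_rob P D yD \<alpha> \<gamma> y u - J_av P D yD \<alpha> \<gamma>' y u = (1 + \<gamma> - \<gamma>') * s"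
    by (simp add: J_rob_def J_av_def s_def algebra_simps)
  moreover have "s \<noteq> 0"
    using assms(6) by (simp add: s_def)
  ultimately show ?thesis
    using mult_eq_0_iff[of "1 + \<gamma> - \<gamma>'" s] by linarith
qed

end
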